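(* There are bounded-degree directed acyclic graphs $G$ with a unique sink on $n$ nodes (for infinitely many $n$) such that: (i) $G$ has black pebbling number $\Theta(\sqrt n)$; (ii) $S(\mathrm{Peb}_G)$ has deterministic decision tree complexity $\Theta(\sqrt n)$; (iii) $\mathrm{bs}_{\mathit{crit}}(S(\mathrm{Peb}_G))=\Theta(\sqrt n)$.
   Context: Black pebble game on a DAG $G$ with unique sink $t$: a pebble may be placed on a node if all its in-neighbours carry pebbles (in particular on sources anytime), and a pebble may be removed from any node; the pebbling number is the minimum number of pebbles simultaneously needed in a sequence of moves that eventually places a pebble on $t$. The pebbling formula $\mathrm{Peb}_G$ has a boolean variable per node and constraints: the sink variable is false; for every node $v$ with in-neighbours $w_1,\dots,w_d$, if all $w_i$ are true then $v$ is true (so sources are true). $S(\mathrm{Peb}_G)$: given an assignment to the nodes, output a violated constraint. The deterministic decision tree complexity is the minimum depth of a decision tree querying input bits that always outputs a violated constraint. For a search problem $S$ (relation with every input having a feasible solution), an input is critical if it has a unique feasible solution; for a total function $f$ selecting a feasible solution for each input, $\mathrm{bs}(f,\alpha)$ is the maximum number of disjoint blocks of variables whose flipping in $\alpha$ changes $f$'s value; $\mathrm{bs}_{\mathit{crit}}(S)=\min_f\max_{\alpha\text{ critical}}\mathrm{bs}(f,\alpha)$. *)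

theory Defs
  imports
    Complex_Main
    "HOL-Library.FuncSet"
    "HOL-Library.Disjoint_Sets"
    "HOL-Library.Landau_Symbols"
    "Graph_Theory.Digraph"
begin

definition dag :: "('a, 'b) pre_digraph \<Rightarrow> bool" where
  "dag G \<longleftrightarrow> digraph G \<and> acyclic (arcs_ends G)"

definition unique_sink :: "('a, 'b) pre_digraph \<Rightarrow> 'a \<Rightarrow> bool" where
  "unique_sink G t \<longleftrightarrow> {v \<in> verts G. out_degree G v = 0} = {t}"

definition in_neighbours :: "('a, 'b) pre_digraph \<Rightarrow> 'a \<Rightarrow> 'a set" where
  "in_neighbours G v = {w. w \<rightarrow>\<^bsub>G\<^esub> v}"


section \<open>The black pebble game\<close>

text \<open>
  A configuration is the set of nodes carrying a pebble. There are no sliding moves.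
\<close>

inductive pebble_move :: "('a, 'b) pre_digraph \<Rightarrow> 'a set \<Rightarrow> 'a set \<Rightarrow> bool"
  for G :: "('a, 'b) pre_digraph" where
  place: "v \<in> verts G \<Longrightarrow> in_neighbours G v \<subseteq> P \<Longrightarrow> pebble_move G P (insert v P)"
| remove: "v \<in> P \<Longrightarrow> pebble_move G P (P - {v})"

definition pebblings :: "('a, 'b) pre_digraph \<Rightarrow> 'a \<Rightarrow> 'a set list set" where
  "pebblings G t =
     {Ps. Ps \<noteq> [] \<and> hd Ps = {} \<and> successively (pebble_move G) Ps \<and> t \<in> last Ps}"

text \<open>
  In this and the following definitions the infimum is one of natural numbers, hence a minimum
  whenever the index set is nonempty.
\<close>

definition pebbling_number :: "('a, 'b) pre_digraph \<Rightarrow> 'a \<Rightarrow> nat" where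
  "pebbling_number G t = (INF Ps \<in> pebblings G t. Max (card ` set Ps))"


section \<open>Search problems over boolean variables\<close>

text \<open>
  A search problem over a set \<open>X\<close> of variables maps each assignment to its set of feasible
  solutions. Assignments are extensional outside \<open>X\<close>, so that each one is a single function.
\<close>

type_synonym ('v, 'q) search_problem = "('v \<Rightarrow> bool) \<Rightarrow> 'q set"

definition assignments :: "'v set \<Rightarrow> ('v \<Rightarrow> bool) set" where
  "assignments X = X \<rightarrow>\<^sub>E UNIV"

definition solvers :: "'v set \<Rightarrow> ('v, 'q) search_problem \<Rightarrow> (('v \<Rightarrow> bool) \<Rightarrow> 'q) set" where
  "solvers X S = {f. \<forall>\<alpha> \<in> assignments X. f \<alpha> \<in> S \<alpha>}"

datatype ('v, 'q) decision_tree =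
  Output 'q
| Query 'v "('v, 'q) decision_tree" "('v, 'q) decision_tree"

primrec run :: "('v, 'q) decision_tree \<Rightarrow> ('v \<Rightarrow> bool) \<Rightarrow> 'q" where
  "run (Output q) \<alpha> = q"
| "run (Query v T\<^sub>0 T\<^sub>1) \<alpha> = (if \<alpha> v then run T\<^sub>1 \<alpha> else run T\<^sub>0 \<alpha>)"

primrec depth :: "('v, 'q) decision_tree \<Rightarrow> nat" where
  "depth (Output q) = 0"
| "depth (Query v T\<^sub>0 T\<^sub>1) = Suc (max (depth T\<^sub>0) (depth T\<^sub>1))"

primrec queried :: "('v, 'q) decision_tree \<Rightarrow> 'v set" where
  "queried (Output q) = {}"
| "queried (Query v T\<^sub>0 T\<^sub>1) = insert v (queried T\<^sub>0 \<union> queried T\<^sub>1)"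

definition decision_tree_complexity :: "'v set \<Rightarrow> ('v, 'q) search_problem \<Rightarrow> nat" where
  "decision_tree_complexity X S =
     (INF T \<in> {T. queried T \<subseteq> X \<and> run T \<in> solvers X S}. depth T)"

definition flip_block :: "('v \<Rightarrow> bool) \<Rightarrow> 'v set \<Rightarrow> 'v \<Rightarrow> bool" where
  "flip_block \<alpha> B = (\<lambda>v. if v \<in> B then \<not> \<alpha> v else \<alpha> v)"

text \<open>
  Sensitive blocks are nonempty automatically, so a family of disjoint blocks may be given as a
  set of blocks.
\<close>

definition block_sensitivity :: "'v set \<Rightarrow> (('v \<Rightarrow> bool) \<Rightarrow> 'q) \<Rightarrow> ('v \<Rightarrow> bool) \<Rightarrow> nat" where
  "block_sensitivity X f \<alpha> =
     Max {card \<B> |\<B>. disjoint \<B> \<and> (\<forall>B \<in> \<B>. B \<subseteq> X \<and> f (flip_block \<alpha> B) \<noteq> f \<alpha>)}"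

definition critical_assignments :: "'v set \<Rightarrow> ('v, 'q) search_problem \<Rightarrow> ('v \<Rightarrow> bool) set" where
  "critical_assignments X S = {\<alpha> \<in> assignments X. \<exists>!q. q \<in> S \<alpha>}"

text \<open>
  For finite \<open>X\<close> the supremum is a maximum, with value \<open>0\<close> if there is no critical assignment.
\<close>

definition bs_crit :: "'v set \<Rightarrow> ('v, 'q) search_problem \<Rightarrow> nat" where
  "bs_crit X S =
     (INF f \<in> solvers X S. SUP \<alpha> \<in> critical_assignments X S. block_sensitivity X f \<alpha>)"


section \<open>Pebbling formulas\<close>

text \<open>
  The constraint that the sink is false and the constraint of the node \<open>t\<close> itself are different
  solutions of the search problem.
\<close>

datatype 'a peb_constraint = Sink_False | Propagation 'a

definition peb_formula :: "('a, 'b) pre_digraph \<Rightarrow> 'a peb_constraint set" where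
  "peb_formula G = insert Sink_False (Propagation ` verts G)"

primrec satisfies ::
  "('a, 'b) pre_digraph \<Rightarrow> 'a \<Rightarrow> ('a \<Rightarrow> bool) \<Rightarrow> 'a peb_constraint \<Rightarrow> bool" where
  "satisfies G t \<alpha> Sink_False \<longleftrightarrow> \<not> \<alpha> t"
| "satisfies G t \<alpha> (Propagation v) \<longleftrightarrow> ((\<forall>w \<in> in_neighbours G v. \<alpha> w) \<longrightarrow> \<alpha> v)"

definition peb_search :: "('a, 'b) pre_digraph \<Rightarrow> 'a \<Rightarrow> ('a, 'a peb_constraint) search_problem" where
  "peb_search G t \<alpha> = {c \<in> peb_formula G. \<not> satisfies G t \<alpha> c}"

lemma peb_search_total:
  assumes "dag G" and "unique_sink G t"
  shows "peb_search G t \<alpha> \<noteq> {}"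
proof
  assume sat: "peb_search G t \<alpha> = {}"
  interpret digraph G using assms(1) by (simp add: dag_def)
  have "finite (arcs_ends G)" by (simp add: arcs_ends_def)
  then have wf: "wf (arcs_ends G)"
    using assms(1) by (auto simp: dag_def intro: finite_acyclic_wf)
  have "v \<in> verts G \<longrightarrow> \<alpha> v" for v
    using wf
  proof (induction v rule: wf_induct_rule)
    case (less v)
    show ?case
    proof
      assume v: "v \<in> verts G"
      have "\<forall>w \<in> in_neighbours G v. \<alpha> w"
        using less adj_in_verts by (auto simp: in_neighbours_def)
      moreover have "satisfies G t \<alpha> (Propagation v)"
        using sat v by (auto simp: peb_search_def peb_formula_def)
      ultimately show "\<alpha> v" by simp
    qed
  qed
  moreover have "t \<in> verts G" using assms(2) by (auto simp: unique_sink_def)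
  ultimately show False
    using sat by (auto simp: peb_search_def peb_formula_def)
qed

end

theory Submission
  imports Defs
begin

text \<open>
  The graph is a binary tree of depth \<open>K\<close> with the nodes of each level identified modulo
  \<open>W = 3 K\<close>, where \<open>K\<close> is a power of \<open>3\<close>, so that \<open>n = 3 K\<^sup>2\<close>. A root-to-leaf path is given by a
  bit string, and flipping bit \<open>i\<close> shifts the later nodes of the path, at level \<open>j\<close>, by
  \<open>2\<close> to the power \<open>j - i - 1\<close> up to sign. As \<open>2\<close> is a primitive root modulo powers of \<open>3\<close>, these shifts
  are distinct modulo \<open>W\<close>. Every path thus has \<open>K - 1\<close> disjoint detours, and each detour is an involution
  of the set of paths.

  This bounds both measures from below. At the moment when all paths first carry a pebble, some path
  carries one only on its source, and all its detours carry one too. And if the nodes of a path and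
  of one of its detours are the false ones, a solver errs from the unique solution of one of the two
  critical assignments, so on average a path has \<open>(K - 1) / 2\<close> sensitive detours.

  The upper bounds come from pebbling level by level, from walking along false nodes, and from the
  bound of block sensitivity by decision tree depth.
\<close>


section \<open>Pebblings\<close>

text \<open>Each move adds or removes one node, starting from the empty set. Lower bounds by
  counting pebbles rest on this, as \<open>card\<close> of an infinite set is 0.\<close>

lemma pebbling_configurations_finite:
  assumes "Ps \<in> pebblings G t" "Q \<in> set Ps"
  shows "finite Q"
proof -
  have "\<forall>Q \<in> set Qs. finite Q" if "successively (pebble_move G) Qs" "finite (hd Qs)" for Qs
    using that
  proof (induction Qs rule: induct_list012)
    case (3 A B Qs)
    then have "pebble_move G A B" and "finite A" by auto
    then have "finite B" by (auto elim: pebble_move.cases)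
    with 3 show ?case by auto
  qed auto
  with assms show ?thesis by (auto simp: pebblings_def)
qed

text \<open>A discrete intermediate value principle. It isolates the move by which all paths become
  blocked.\<close>

lemma successively_first_change:
  assumes "successively R xs" "xs \<noteq> []" "\<not> P (hd xs)" "P (last xs)"
  obtains x y where "y \<in> set xs" "R x y" "\<not> P x" "P y"
proof -
  have "\<exists>x y. y \<in> set xs \<and> R x y \<and> \<not> P x \<and> P y"
    using assms
  proof (induction xs rule: induct_list012)
    case (3 x y zs)
    then show ?case by (cases "P y") auto
  qed auto
  with that show thesis by blast
qed

lemma bounded_pebbling_list:
  assumes "(\<lambda>P Q. pebble_move G P Q \<and> card Q \<le> c)\<^sup>*\<^sup>* {} Q" "t \<in> Q"
  obtains Ps where "Ps \<in> pebblings G t" "\<forall>P \<in> set Ps. card P \<le> c"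
proof -
  have "\<exists>Ps. Ps \<noteq> [] \<and> hd Ps = {} \<and> successively (pebble_move G) Ps \<and> last Ps = Q \<and>
          (\<forall>P \<in> set Ps. card P \<le> c)"
    using assms(1)
  proof (induction rule: rtranclp_induct)
    case base
    show ?case by (intro exI[of _ "[{}]"]) simp
  next
    case (step P Q)
    then obtain Ps where "Ps \<noteq> []" "hd Ps = {}" "successively (pebble_move G) Ps"
      "last Ps = P" "\<forall>P \<in> set Ps. card P \<le> c" by blast
    with step.hyps show ?case
      by (intro exI[of _ "Ps @ [Q]"]) (auto simp: successively_append_iff)
  qed
  with assms(2) that show thesis by (auto simp: pebblings_def)
qed

section \<open>Bounds on the pebbling number from bounds on single pebblings\<close>

lemma pebbling_number_le:
  assumes "Ps \<in> pebblings G t" "\<forall>P \<in> set Ps. card P \<le> c"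
  shows "pebbling_number G t \<le> c"
proof -
  have "pebbling_number G t \<le> Max (card ` set Ps)"
    unfolding pebbling_number_def using assms(1) by (intro cINF_lower) auto
  also have "\<dots> \<le> c"
    using assms by (subst Max_le_iff) (auto simp: pebblings_def)
  finally show ?thesis .
qed

lemma pebbling_number_ge:
  assumes "pebblings G t \<noteq> {}" "\<And>Ps. Ps \<in> pebblings G t \<Longrightarrow> \<exists>P \<in> set Ps. c \<le> card P"
  shows "c \<le> pebbling_number G t"
  unfolding pebbling_number_def
proof (rule cINF_greatest)
  fix Ps assume "Ps \<in> pebblings G t"
  then obtain P where "P \<in> set Ps" "c \<le> card P" using assms(2) by blast
  then show "c \<le> Max (card ` set Ps)" by (meson List.finite_set Max_ge finite_imageI imageI order_trans)
qed (fact assms(1))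

text \<open>Pebble the nodes in descending order, keeping only a window of width \<open>c\<close>.\<close>

lemma bounded_pebbling_of_bandwidth:
  assumes verts: "verts G = {..<n}" and "0 < n"
    and bw: "\<And>u. u < n \<Longrightarrow> in_neighbours G u \<subseteq> {u<..<min n (u + c)}"
  obtains Ps where "Ps \<in> pebblings G 0" "\<forall>P \<in> set Ps. card P \<le> Suc c"
proof -
  let ?R = "\<lambda>P Q. pebble_move G P Q \<and> card Q \<le> Suc c"
  \<comment> \<open>Invariant: once the top \<open>k\<close> nodes have been handled, exactly the
    lowest \<open>c\<close> of them keep pebbles, or all of them if there are fewer.\<close>
  have "?R\<^sup>*\<^sup>* {} {n - k..<min n (n - k + c)}" if "k \<le> n" for k
    using that
  proof (induction k)
    case 0
    then show ?case by simp
  next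
    case (Suc k)
    define u where "u = n - Suc k"
    have u: "n - k = Suc u" "u < n" using Suc.prems by (auto simp: u_def)
    let ?P = "{Suc u..<min n (Suc u + c)}"
    have ins: "insert u ?P = {u..<min n (Suc u + c)}" using u by auto
    have "?R ?P (insert u ?P)"
    proof
      show "pebble_move G ?P (insert u ?P)"
        using verts u bw[OF u(2)] by (intro pebble_move.place) auto
    qed (simp add: ins)
    moreover have "?R\<^sup>*\<^sup>* (insert u ?P) {u..<min n (u + c)}"
    proof (cases "u + c < n")
      case True
      have *: "{u..<min n (u + c)} = insert u ?P - {u + c}"
        using True by (auto simp: ins min_def)
      have "pebble_move G (insert u ?P) (insert u ?P - {u + c})"
        using True by (intro pebble_move.remove) auto
      then have "?R (insert u ?P) {u..<min n (u + c)}" unfolding *[symmetric] by simp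
      then show ?thesis by blast
    next
      case False
      then have "insert u ?P = {u..<min n (u + c)}" unfolding ins by auto
      then show ?thesis by (metis (no_types, lifting) rtranclp.rtrancl_refl)
    qed
    moreover have "?R\<^sup>*\<^sup>* {} ?P" using Suc u(1) by simp
    ultimately have "?R\<^sup>*\<^sup>* {} {u..<min n (u + c)}"
      using rtranclp.rtrancl_into_rtrancl[of ?R "{}" ?P "insert u ?P"]
        rtranclp_trans[of ?R "{}" "insert u ?P"] by blast
    then show ?case by (simp add: u_def)
  qed
  from this[of n] have reach: "?R\<^sup>*\<^sup>* {} {0..<min n c}" by simp
  show thesis
  proof (cases "c = 0")
    \<comment> \<open>The final window is empty for \<open>c = 0\<close>, so node 0 gets its pebble
      separately; the bandwidth hypothesis makes it a source.\<close>
    case True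
    have "?R {} {0}"
      using verts \<open>0 < n\<close> bw[of 0] True by (auto intro!: pebble_move.place[of 0 G "{}"])
    then have "?R\<^sup>*\<^sup>* {} {0}" by blast
    from bounded_pebbling_list[OF this] that show thesis by auto
  next
    case False
    with \<open>0 < n\<close> bounded_pebbling_list[OF reach] that show thesis by auto
  qed
qed


section \<open>Decision trees and block sensitivity\<close>

lemma depth_attained:
  assumes "T\<^sub>0 \<in> {T. queried T \<subseteq> X \<and> run T \<in> solvers X S}"
  obtains T where "queried T \<subseteq> X" "run T \<in> solvers X S"
    "depth T = decision_tree_complexity X S"
proof -
  have "decision_tree_complexity X S \<in> depth ` {T. queried T \<subseteq> X \<and> run T \<in> solvers X S}"
    unfolding decision_tree_complexity_def using assms by (intro Inf_nat_def1) blast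
  with that show thesis by auto
qed

lemma decision_tree_complexity_le:
  assumes "queried T \<subseteq> X" "run T \<in> solvers X S"
  shows "decision_tree_complexity X S \<le> depth T"
  unfolding decision_tree_complexity_def using assms by (intro cINF_lower) auto

text \<open>\<open>Q\<close> collects the variables queried on the branch that \<alpha> takes; an
  assignment agreeing with \<alpha> on them takes the same branch.\<close>

lemma decision_tree_certificate:
  obtains Q where "finite Q" "card Q \<le> depth T"
    "\<And>\<beta>. (\<And>v. v \<in> Q \<Longrightarrow> \<beta> v = \<alpha> v) \<Longrightarrow> run T \<beta> = run T \<alpha>"
proof -
  have "\<exists>Q. finite Q \<and> card Q \<le> depth T \<and> (\<forall>\<beta>. (\<forall>v \<in> Q. \<beta> v = \<alpha> v) \<longrightarrow> run T \<beta> = run T \<alpha>)"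
  proof (induction T)
    case (Output q)
    show ?case by (intro exI[of _ "{}"]) simp
  next
    case (Query v T\<^sub>0 T\<^sub>1)
    define T where "T = (if \<alpha> v then T\<^sub>1 else T\<^sub>0)"
    have "\<exists>Q. finite Q \<and> card Q \<le> depth T \<and> (\<forall>\<beta>. (\<forall>w \<in> Q. \<beta> w = \<alpha> w) \<longrightarrow> run T \<beta> = run T \<alpha>)"
    proof (cases "\<alpha> v")
      case True
      then have T: "T = T\<^sub>1" by (simp add: T_def)
      show ?thesis unfolding T by (fact Query(2))
    next
      case False
      then have T: "T = T\<^sub>0" by (simp add: T_def)
      show ?thesis unfolding T by (fact Query(1))
    qed
    then obtain Q where Q: "finite Q" "card Q \<le> depth T"
      "\<forall>\<beta>. (\<forall>w \<in> Q. \<beta> w = \<alpha> w) \<longrightarrow> run T \<beta> = run T \<alpha>" by blast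
    have step: "run (Query v T\<^sub>0 T\<^sub>1) \<beta> = run T \<beta>" if "\<beta> v = \<alpha> v" for \<beta>
      using that by (simp add: T_def)
    show ?case
    proof (intro exI[of _ "insert v Q"] conjI allI impI)
      show "finite (insert v Q)" using Q(1) by simp
      have "card (insert v Q) \<le> Suc (depth T)"
        using Q(1,2) by (simp add: card_insert_if)
      then show "card (insert v Q) \<le> depth (Query v T\<^sub>0 T\<^sub>1)"
        by (simp add: T_def split: if_splits)
      fix \<beta> assume \<beta>: "\<forall>w \<in> insert v Q. \<beta> w = \<alpha> w"
      then have "\<forall>w \<in> Q. \<beta> w = \<alpha> w" and v: "\<beta> v = \<alpha> v" by auto
      with Q(3) have eq: "run T \<beta> = run T \<alpha>" by (elim allE) (rule mp)
      show "run (Query v T\<^sub>0 T\<^sub>1) \<beta> = run (Query v T\<^sub>0 T\<^sub>1) \<alpha>"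
        unfolding step[of \<beta>, OF v] step[of \<alpha>, OF refl] by (fact eq)
    qed
  qed
  then obtain Q where Q: "finite Q" "card Q \<le> depth T"
    "\<forall>\<beta>. (\<forall>v \<in> Q. \<beta> v = \<alpha> v) \<longrightarrow> run T \<beta> = run T \<alpha>" by (elim exE conjE)
  show thesis
  proof (rule that[OF Q(1,2)])
    fix \<beta> assume "\<And>v. v \<in> Q \<Longrightarrow> \<beta> v = \<alpha> v"
    then show "run T \<beta> = run T \<alpha>" by (intro Q(3)[rule_format])
  qed
qed

text \<open>Choosing a point of \<open>Q\<close> in each member is injective by disjointness. This
  serves twice: for sensitive blocks against queried variables, and for detours against
  pebbles.\<close>

lemma card_disjoint_family_le:
  assumes "finite Q" "disjoint \<B>" "\<And>B. B \<in> \<B> \<Longrightarrow> B \<inter> Q \<noteq> {}"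
  shows "finite \<B>" "card \<B> \<le> card Q"
proof -
  have "\<forall>B \<in> \<B>. \<exists>x. x \<in> B \<inter> Q" using assms(3) by blast
  from bchoice[OF this] obtain g where g: "\<forall>B \<in> \<B>. g B \<in> B \<inter> Q" by blast
  have inj: "inj_on g \<B>"
  proof (rule inj_onI)
    fix A B assume "A \<in> \<B>" "B \<in> \<B>" "g A = g B"
    then have "g A \<in> A \<inter> B" using g by auto
    with \<open>A \<in> \<B>\<close> \<open>B \<in> \<B>\<close> show "A = B" using disjointD[OF assms(2)] by blast
  qed
  have sub: "g ` \<B> \<subseteq> Q" using g by blast
  show "finite \<B>" by (rule inj_on_finite[OF inj sub assms(1)])
  show "card \<B> \<le> card Q" by (rule card_inj_on_le[OF inj sub assms(1)])
qed

lemma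
  assumes "finite X"
  shows finite_block_families:
      "finite {card \<B> |\<B>. disjoint \<B> \<and> (\<forall>B \<in> \<B>. B \<subseteq> X \<and> f (flip_block \<alpha> B) \<noteq> f \<alpha>)}" (is "finite ?F")
    and block_families_nonempty:
      "{card \<B> |\<B>. disjoint \<B> \<and> (\<forall>B \<in> \<B>. B \<subseteq> X \<and> f (flip_block \<alpha> B) \<noteq> f \<alpha>)} \<noteq> {}"
proof -
  have "?F \<subseteq> card ` Pow (Pow X)" by blast
  then show "finite ?F" using assms by (meson finite_Pow_iff finite_imageI finite_subset)
  have "card ({} :: 'a set set) \<in> ?F" by (intro CollectI exI[of _ "{}"]) auto
  then show "?F \<noteq> {}" by blast
qed

lemma block_sensitivity_ge:
  assumes "finite X" "disjoint \<B>" "\<And>B. B \<in> \<B> \<Longrightarrow> B \<subseteq> X \<and> f (flip_block \<alpha> B) \<noteq> f \<alpha>"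
  shows "card \<B> \<le> block_sensitivity X f \<alpha>"
  unfolding block_sensitivity_def
  using assms(2,3) by (intro Max_ge finite_block_families[OF assms(1)]) blast

text \<open>A sensitive block must meet the certificate of \<alpha>, and disjoint blocks meet it in
  different variables.\<close>

lemma block_sensitivity_le_depth:
  assumes "finite X"
  shows "block_sensitivity X (run T) \<alpha> \<le> depth T"
  unfolding block_sensitivity_def
proof (rule Max.boundedI[OF finite_block_families[OF assms] block_families_nonempty[OF assms]])
  fix k assume "k \<in> {card \<B> |\<B>. disjoint \<B> \<and>
    (\<forall>B \<in> \<B>. B \<subseteq> X \<and> run T (flip_block \<alpha> B) \<noteq> run T \<alpha>)}"
  then obtain \<B> where \<B>: "k = card \<B>" "disjoint \<B>"
    "\<And>B. B \<in> \<B> \<Longrightarrow> run T (flip_block \<alpha> B) \<noteq> run T \<alpha>" by blast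
  obtain Q where Q: "finite Q" "card Q \<le> depth T"
    "\<And>\<beta>. (\<And>v. v \<in> Q \<Longrightarrow> \<beta> v = \<alpha> v) \<Longrightarrow> run T \<beta> = run T \<alpha>"
    using decision_tree_certificate[of T \<alpha>] by blast
  have "B \<inter> Q \<noteq> {}" if "B \<in> \<B>" for B
  proof
    assume "B \<inter> Q = {}"
    then have "run T (flip_block \<alpha> B) = run T \<alpha>"
      by (intro Q(3)) (auto simp: flip_block_def)
    with \<B>(3) that show False by blast
  qed
  then have "card \<B> \<le> card Q" using card_disjoint_family_le[OF Q(1) \<B>(2)] by blast
  with \<B>(1) Q(2) show "k \<le> depth T" by simp
qed

lemma finite_assignments: "finite X \<Longrightarrow> finite (assignments X)"
  by (simp add: assignments_def finite_PiE)

text \<open>The function computed by an optimal tree is one of the solvers over which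
  \<open>bs_crit\<close> minimises.\<close>

lemma bs_crit_le_decision_tree_complexity:
  assumes "finite X" and T\<^sub>0: "T\<^sub>0 \<in> {T. queried T \<subseteq> X \<and> run T \<in> solvers X S}"
  shows "bs_crit X S \<le> decision_tree_complexity X S"
proof -
  obtain T where T: "queried T \<subseteq> X" "run T \<in> solvers X S"
    "depth T = decision_tree_complexity X S"
    using depth_attained[OF T\<^sub>0] by blast
  have "bs_crit X S \<le> (SUP \<alpha> \<in> critical_assignments X S. block_sensitivity X (run T) \<alpha>)"
    unfolding bs_crit_def using T(2) by (intro cINF_lower) auto
  also have "\<dots> \<le> depth T"
  \<comment> \<open>Bounding a supremum from above needs a nonempty index set; the empty supremum of
    naturals is 0.\<close>
  proof (cases "critical_assignments X S = {}")
    case False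
    then show ?thesis by (intro cSUP_least block_sensitivity_le_depth assms(1))
  qed simp
  finally show ?thesis using T(3) by simp
qed

lemma bs_crit_ge:
  assumes "finite X" "solvers X S \<noteq> {}"
    and "\<And>f. f \<in> solvers X S \<Longrightarrow> \<exists>\<alpha> \<in> critical_assignments X S. c \<le> block_sensitivity X f \<alpha>"
  shows "c \<le> bs_crit X S"
  unfolding bs_crit_def
proof (rule cINF_greatest)
  show "solvers X S \<noteq> {}" by (fact assms(2))
  fix f assume "f \<in> solvers X S"
  then obtain \<alpha> where \<alpha>: "\<alpha> \<in> critical_assignments X S" "c \<le> block_sensitivity X f \<alpha>"
    using assms(3) by blast
  have "finite (critical_assignments X S)"
    using finite_assignments[OF assms(1)] unfolding critical_assignments_def by simp
  \<comment> \<open>On naturals, \<open>SUP\<close> is known to dominate its members only for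
    bounded families.\<close>
  then have "bdd_above (block_sensitivity X f ` critical_assignments X S)"
    by (intro bdd_above_finite finite_imageI)
  from \<alpha>(2) cSUP_upper[OF \<alpha>(1) this]
  show "c \<le> (SUP \<alpha> \<in> critical_assignments X S. block_sensitivity X f \<alpha>)"
    by (rule order_trans)
qed

text \<open>
  From a false node, query the in-neighbours until a false one is found, and continue there.
\<close>

lemma peb_search_tree:
  fixes r :: "'a \<Rightarrow> nat"
  assumes finite_in: "\<And>v. v \<in> verts G \<Longrightarrow> finite (in_neighbours G v)"
    and in_verts: "\<And>v. v \<in> verts G \<Longrightarrow> in_neighbours G v \<subseteq> verts G"
    and card_in: "\<And>v. v \<in> verts G \<Longrightarrow> card (in_neighbours G v) \<le> d"
    and rank: "\<And>v w. v \<in> verts G \<Longrightarrow> w \<in> in_neighbours G v \<Longrightarrow> r w < r v"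
    and "v \<in> verts G"
  shows "\<exists>T. queried T \<subseteq> verts G \<and> depth T \<le> d * Suc (r v) \<and>
           (\<forall>\<alpha>. \<not> \<alpha> v \<longrightarrow> run T \<alpha> \<in> peb_search G t \<alpha>)"
  using \<open>v \<in> verts G\<close>
proof (induction "r v" arbitrary: v rule: less_induct)
  case less
  have "\<forall>w \<in> in_neighbours G v. \<exists>T. queried T \<subseteq> verts G \<and> depth T \<le> d * Suc (r w) \<and>
      (\<forall>\<alpha>. \<not> \<alpha> w \<longrightarrow> run T \<alpha> \<in> peb_search G t \<alpha>)"
    using less rank in_verts by blast
  then obtain T where T: "\<And>w. w \<in> in_neighbours G v \<Longrightarrow> queried (T w) \<subseteq> verts G"
      "\<And>w. w \<in> in_neighbours G v \<Longrightarrow> depth (T w) \<le> d * Suc (r w)"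
      "\<And>w \<alpha>. w \<in> in_neighbours G v \<Longrightarrow> \<not> \<alpha> w \<Longrightarrow> run (T w) \<alpha> \<in> peb_search G t \<alpha>"
    by metis
  obtain ws where ws: "set ws = in_neighbours G v" "length ws = card (in_neighbours G v)"
    using finite_in[OF less.prems] by (metis distinct_card finite_distinct_list)
  \<comment> \<open>A false answer leaves the list for the subtree of that node, a true one moves on
    to the next node. At most \<open>d\<close> queries go into the list, and the drop in rank leaves
    \<open>d * r v\<close> for the subtree.\<close>
  define scan where "scan = foldr (\<lambda>w U. Query w (T w) U)"
  have depth: "depth (scan us (Output q)) \<le> length us + d * r v"
    if "set us \<subseteq> in_neighbours G v" for us and q
    using that
  proof (induction us)
    case (Cons w us)
    then have "depth (T w) \<le> d * Suc (r w)" using T(2) by auto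
    also have "\<dots> \<le> d * r v"
      using Cons.prems rank[OF less.prems] by (intro mult_le_mono2) (auto simp: Suc_le_eq)
    finally show ?case using Cons by (simp add: scan_def)
  qed (simp add: scan_def)
  have queried: "queried (scan us (Output q)) \<subseteq> verts G"
    if "set us \<subseteq> in_neighbours G v" for us and q
    using that
  proof (induction us)
    case (Cons w us)
    then show ?case using T(1)[of w] in_verts[OF less.prems] by (auto simp: scan_def)
  qed (simp add: scan_def)
  have run: "run (scan us (Output q)) \<alpha> \<in> peb_search G t \<alpha>"
    if "set us \<subseteq> in_neighbours G v" "(\<forall>w \<in> set us. \<alpha> w) \<longrightarrow> q \<in> peb_search G t \<alpha>" for us \<alpha> q
    using that
  proof (induction us)
    case (Cons w us)
    then show ?case using T(3)[of w \<alpha>] by (auto simp: scan_def)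
  qed (simp add: scan_def)
  show ?case
  proof (intro exI[of _ "scan ws (Output (Propagation v))"] conjI allI impI)
    show "queried (scan ws (Output (Propagation v))) \<subseteq> verts G" using queried ws(1) by blast
    have "depth (scan ws (Output (Propagation v))) \<le> length ws + d * r v"
      using depth ws(1) by blast
    then show "depth (scan ws (Output (Propagation v))) \<le> d * Suc (r v)"
      using card_in[OF less.prems] ws(2) by simp
    show "run (scan ws (Output (Propagation v))) \<alpha> \<in> peb_search G t \<alpha>" if "\<not> \<alpha> v" for \<alpha>
      using that ws(1) less.prems by (intro run) (auto simp: peb_search_def peb_formula_def)
  qed
qed

text \<open>One extra query asks for the sink: if it is true, \<open>Sink_False\<close> is violated;
  if it is false, the walk along false nodes starts there.\<close>

lemma peb_search_solving_tree:
  fixes r :: "'a \<Rightarrow> nat"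
  assumes "\<And>v. v \<in> verts G \<Longrightarrow> finite (in_neighbours G v)"
    and "\<And>v. v \<in> verts G \<Longrightarrow> in_neighbours G v \<subseteq> verts G"
    and "\<And>v. v \<in> verts G \<Longrightarrow> card (in_neighbours G v) \<le> d"
    and "\<And>v w. v \<in> verts G \<Longrightarrow> w \<in> in_neighbours G v \<Longrightarrow> r w < r v"
    and t: "t \<in> verts G"
  obtains T where "queried T \<subseteq> verts G" "run T \<in> solvers (verts G) (peb_search G t)"
    "depth T \<le> Suc (d * Suc (r t))"
proof -
  obtain T where T: "queried T \<subseteq> verts G" "depth T \<le> d * Suc (r t)"
    "\<And>\<alpha>. \<not> \<alpha> t \<Longrightarrow> run T \<alpha> \<in> peb_search G t \<alpha>"
    using peb_search_tree[of G d r t t, OF assms] by blast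
  show thesis
  proof (rule that[of "Query t T (Output Sink_False)"])
    show "run (Query t T (Output Sink_False)) \<in> solvers (verts G) (peb_search G t)"
      using T(3) by (auto simp: solvers_def peb_search_def peb_formula_def)
  qed (use T t in auto)
qed


section \<open>Branching path systems\<close>

text \<open>
  The sets \<open>P b\<close> are node sets of paths from the source \<open>e b\<close> to the sink. For each \<open>i\<close>
  the involution \<open>\<sigma> i\<close> reroutes every path, and the parts where the \<open>m\<close> rerouted
  paths leave \<open>P b\<close> are pairwise disjoint.
\<close>

locale branching_paths =
  fixes G :: "('a, 'b) pre_digraph" and t :: 'a and I :: "'i set" and P :: "'i \<Rightarrow> 'a set"
    and e :: "'i \<Rightarrow> 'a" and m :: nat and \<sigma> :: "nat \<Rightarrow> 'i \<Rightarrow> 'i"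
  assumes dag: "dag G" and sink: "unique_sink G t"
    and finite_I: "finite I" and I_nonempty: "I \<noteq> {}"
    and P_verts: "b \<in> I \<Longrightarrow> P b \<subseteq> verts G"
    and sink_in_P: "b \<in> I \<Longrightarrow> t \<in> P b"
    and end_in_P: "b \<in> I \<Longrightarrow> e b \<in> P b"
    and end_source: "b \<in> I \<Longrightarrow> in_neighbours G (e b) = {}"
    and P_pred: "b \<in> I \<Longrightarrow> v \<in> P b \<Longrightarrow> v \<noteq> e b \<Longrightarrow> in_neighbours G v \<inter> P b \<noteq> {}"
    and \<sigma>_in: "i < m \<Longrightarrow> b \<in> I \<Longrightarrow> \<sigma> i b \<in> I"
    and \<sigma>_\<sigma>: "i < m \<Longrightarrow> b \<in> I \<Longrightarrow> \<sigma> i (\<sigma> i b) = b"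
    and end_notin: "i < m \<Longrightarrow> b \<in> I \<Longrightarrow> e b \<notin> P (\<sigma> i b)"
    and branches_disjoint: "i < l \<Longrightarrow> l < m \<Longrightarrow> b \<in> I \<Longrightarrow> P (\<sigma> i b) \<inter> P (\<sigma> l b) \<subseteq> P b"
begin

section \<open>Detours as disjoint blocks, and the pebbling lower bound\<close>

lemma finite_verts: "finite (verts G)"
  using dag fin_digraph.finite_verts by (auto simp: dag_def digraph_def)

lemma branches_disjoint':
  assumes "b \<in> I" "i < m" "l < m" "i \<noteq> l"
  shows "(P (\<sigma> i b) - P b) \<inter> (P (\<sigma> l b) - P b) = {}"
  using assms branches_disjoint[of i l b] branches_disjoint[of l i b] by (cases "i < l") auto

lemma branches_image_disjoint:
  assumes "b \<in> I" "J \<subseteq> {..<m}"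
  shows "disjoint ((\<lambda>i. P (\<sigma> i b) - P b) ` J)"
  unfolding disjoint_def
proof (intro ballI impI; elim imageE)
  fix A B i l
  assume "A \<noteq> B" "i \<in> J" "l \<in> J" "A = P (\<sigma> i b) - P b" "B = P (\<sigma> l b) - P b"
  then show "A \<inter> B = {}" using branches_disjoint'[OF assms(1), of i l] assms(2) by auto
qed

text \<open>The source of the rerouted path is off \<open>P b\<close>: this is
  \<open>end_notin\<close> for \<open>\<sigma> i b\<close>, which \<open>\<sigma> i\<close> reroutes
  back to \<open>b\<close>.\<close>

lemma branch_nonempty:
  assumes "b \<in> I" "i < m"
  shows "P (\<sigma> i b) - P b \<noteq> {}"
  using assms end_notin[of i "\<sigma> i b"] \<sigma>_\<sigma> end_in_P[of "\<sigma> i b"] \<sigma>_in by auto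

text \<open>Disjoint nonempty sets differ, so passing from indices to sets of blocks loses nothing
  in the count.\<close>

lemma branches_inj:
  assumes "b \<in> I"
  shows "inj_on (\<lambda>i. P (\<sigma> i b) - P b) {..<m}"
  using branches_disjoint'[OF assms] branch_nonempty[OF assms]
  by (intro inj_onI) (metis Int_absorb lessThan_iff)

lemma pebbling_needs_many_pebbles:
  assumes Ps: "Ps \<in> pebblings G t"
  shows "\<exists>Q \<in> set Ps. Suc m \<le> card Q"
proof -
  define blocked where "blocked = (\<lambda>Q. \<forall>b \<in> I. P b \<inter> Q \<noteq> {})"
  obtain Q Q' where Q: "Q' \<in> set Ps" "pebble_move G Q Q'" "\<not> blocked Q" "blocked Q'"
  proof (rule successively_first_change[of "pebble_move G" Ps blocked])
    show "\<not> blocked (hd Ps)" "blocked (last Ps)"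
      using Ps I_nonempty sink_in_P by (auto simp: pebblings_def blocked_def)
  qed (use Ps in \<open>auto simp: pebblings_def\<close>)
  obtain b where b: "b \<in> I" "P b \<inter> Q = {}" using Q(3) by (auto simp: blocked_def)
  have meet: "P b \<inter> Q' \<noteq> {}" using Q(4) b(1) by (simp add: blocked_def)
  \<comment> \<open>A removal cannot block the free path \<open>P b\<close>, so the move places a
    pebble on it. The in-neighbours of the new node carry pebbles and are thus off
    \<open>P b\<close>, which by \<open>P_pred\<close> leaves only the source.\<close>
  have Q': "Q' = insert (e b) Q"
    using Q(2)
  proof cases
    case (place v)
    then have "v \<in> P b" using meet b(2) by auto
    moreover have "in_neighbours G v \<inter> P b = {}" using place b(2) by blast
    ultimately have "v = e b" using P_pred[OF b(1)] by blast
    with place show ?thesis by simp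
  next
    case (remove v)
    with meet b(2) show ?thesis by auto
  qed
  have fin: "finite Q'" using pebbling_configurations_finite[OF Ps Q(1)] .
  define \<B> where "\<B> = (\<lambda>i. P (\<sigma> i b) - P b) ` {..<m}"
  have "card \<B> = m" using branches_inj[OF b(1)] by (simp add: \<B>_def card_image)
  \<comment> \<open>The pebble on \<open>e b\<close> lies on no rerouted path, so the detours
    account for \<open>m\<close> further pebbles.\<close>
  moreover have "card \<B> \<le> card (Q' - {e b})"
  proof (rule card_disjoint_family_le(2))
    show "disjoint \<B>" unfolding \<B>_def by (rule branches_image_disjoint[OF b(1)]) blast
    fix B assume "B \<in> \<B>"
    then obtain i where i: "i < m" "B = P (\<sigma> i b) - P b" by (auto simp: \<B>_def)
    have "P (\<sigma> i b) \<inter> Q' \<noteq> {}" using Q(4) \<sigma>_in[OF i(1) b(1)] by (auto simp: blocked_def)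
    then show "B \<inter> (Q' - {e b}) \<noteq> {}"
      using Q' b(2) end_notin[OF i(1) b(1)] i(2) by auto
  qed (use fin in simp)
  moreover have "card (Q' - {e b}) < card Q'" using fin Q' by (intro card_Diff1_less) auto
  ultimately show ?thesis using Q(1) by (intro bexI[of _ Q']) auto
qed

section \<open>Critical assignments from paths, and the block sensitivity lower bound\<close>

definition path_assignment :: "'i \<Rightarrow> 'a \<Rightarrow> bool" where
  "path_assignment b = (\<lambda>v \<in> verts G. v \<notin> P b)"

text \<open>Every false node except the source has a false in-neighbour on the path, so its
  constraint holds vacuously; the sink is false as well.\<close>

lemma peb_search_path_assignment:
  assumes b: "b \<in> I"
  shows "peb_search G t (path_assignment b) = {Propagation (e b)}"
proof (intro equalityI subsetI)
  fix c assume c: "c \<in> peb_search G t (path_assignment b)"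
  have "t \<in> verts G" using b sink_in_P P_verts by blast
  then have "c \<noteq> Sink_False"
    using c b sink_in_P by (auto simp: peb_search_def path_assignment_def)
  then obtain v where v: "c = Propagation v" "v \<in> verts G" "v \<in> P b"
    "\<forall>w \<in> in_neighbours G v. path_assignment b w"
    using c by (auto simp: peb_search_def peb_formula_def path_assignment_def)
  have "in_neighbours G v \<inter> P b = {}"
    using v(4) P_verts[OF b] by (auto simp: path_assignment_def)
  then have "v = e b" using P_pred[OF b v(3)] by blast
  with v(1) show "c \<in> {Propagation (e b)}" by simp
next
  fix c assume "c \<in> {Propagation (e b)}"
  then show "c \<in> peb_search G t (path_assignment b)"
    using b end_source[OF b] end_in_P[OF b] P_verts[OF b]
    by (auto simp: peb_search_def peb_formula_def path_assignment_def)
qed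

lemma path_assignment_critical:
  assumes "b \<in> I"
  shows "path_assignment b \<in> critical_assignments (verts G) (peb_search G t)"
  using peb_search_path_assignment[OF assms]
  by (simp add: critical_assignments_def assignments_def) (simp add: path_assignment_def)

text \<open>On both sides the false nodes are exactly those of the two paths.\<close>

lemma flip_branch:
  assumes "b \<in> I" "i < m"
  shows "flip_block (path_assignment b) (P (\<sigma> i b) - P b) =
         flip_block (path_assignment (\<sigma> i b)) (P b - P (\<sigma> i b))"
  using P_verts[OF assms(1)] P_verts[OF \<sigma>_in[OF assms(2,1)]]
  by (auto simp: flip_block_def path_assignment_def fun_eq_iff)

text \<open>Both flips give one assignment with one answer, while the forced answers at the two
  critical assignments name different sources.\<close>

lemma solver_sensitive_to_branch:
  assumes f: "f \<in> solvers (verts G) (peb_search G t)" and b: "b \<in> I" and i: "i < m"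
  shows "f (flip_block (path_assignment b) (P (\<sigma> i b) - P b)) \<noteq> f (path_assignment b) \<or>
         f (flip_block (path_assignment (\<sigma> i b)) (P b - P (\<sigma> i b))) \<noteq> f (path_assignment (\<sigma> i b))"
proof -
  have f_path: "f (path_assignment a) = Propagation (e a)" if "a \<in> I" for a
  proof -
    have "path_assignment a \<in> assignments (verts G)"
      using path_assignment_critical[OF that] by (simp add: critical_assignments_def)
    then have "f (path_assignment a) \<in> peb_search G t (path_assignment a)"
      using f by (simp add: solvers_def)
    then show ?thesis using peb_search_path_assignment[OF that] by simp
  qed
  have "e b \<noteq> e (\<sigma> i b)"
    using end_notin[OF i b] end_in_P[OF \<sigma>_in[OF i b]] by auto
  then show ?thesis
    using flip_branch[OF b i] f_path[OF b] f_path[OF \<sigma>_in[OF i b]] by auto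
qed

text \<open>Double counting of the pairs of a path and a sensitive detour: every index
  \<open>i\<close> is sensitive for at least half of the paths, so some path has at least half of
  the indices.\<close>

lemma exists_half_sensitive:
  assumes f: "f \<in> solvers (verts G) (peb_search G t)"
  shows "\<exists>b \<in> I. m \<le> 2 * block_sensitivity (verts G) f (path_assignment b)"
proof (rule ccontr)
  define sens where "sens b i \<longleftrightarrow>
    f (flip_block (path_assignment b) (P (\<sigma> i b) - P b)) \<noteq> f (path_assignment b)" for b i
  assume neg: "\<not> ?thesis"
  have few: "2 * card {i \<in> {..<m}. sens b i} < m" if b: "b \<in> I" for b
  proof -
    let ?J = "{i \<in> {..<m}. sens b i}"
    let ?\<B> = "(\<lambda>i. P (\<sigma> i b) - P b) ` ?J"
    have "card ?\<B> \<le> block_sensitivity (verts G) f (path_assignment b)"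
    proof (rule block_sensitivity_ge[OF finite_verts])
      show "disjoint ?\<B>" by (rule branches_image_disjoint[OF b]) blast
      show "B \<subseteq> verts G \<and> f (flip_block (path_assignment b) B) \<noteq> f (path_assignment b)"
        if "B \<in> ?\<B>" for B
      proof -
        from that obtain i where "i < m" "sens b i" "B = P (\<sigma> i b) - P b" by blast
        then show ?thesis using P_verts[OF \<sigma>_in[OF _ b]] unfolding sens_def by blast
      qed
    qed
    moreover have "card ?\<B> = card ?J"
      by (intro card_image inj_on_subset[OF branches_inj[OF b]]) blast
    moreover have "\<not> m \<le> 2 * block_sensitivity (verts G) f (path_assignment b)"
      using neg b by blast
    ultimately show ?thesis by linarith
  qed
  \<comment> \<open>Each \<open>b\<close> or its partner \<open>\<sigma> i b\<close> is sensitive;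
    summed over all paths, the partners contribute the same total because \<open>\<sigma> i\<close>
    permutes \<open>I\<close>.\<close>
  have each: "card I \<le> 2 * (\<Sum>b\<in>I. of_bool (sens b i))" if i: "i < m" for i
  proof -
    have bij: "bij_betw (\<sigma> i) I I"
      using \<sigma>_in[OF i] \<sigma>_\<sigma>[OF i] by (intro bij_betwI[where g = "\<sigma> i"]) auto
    have "card I = (\<Sum>b\<in>I. 1)" by simp
    also have "\<dots> \<le> (\<Sum>b\<in>I. of_bool (sens b i) + of_bool (sens (\<sigma> i b) i))"
    proof (rule sum_mono)
      fix b assume "b \<in> I"
      then show "1 \<le> of_bool (sens b i) + (of_bool (sens (\<sigma> i b) i) :: nat)"
        unfolding sens_def using solver_sensitive_to_branch[OF f _ i, of b] \<sigma>_\<sigma>[OF i, of b]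
        by (cases "f (flip_block (path_assignment b) (P (\<sigma> i b) - P b)) = f (path_assignment b)") simp_all
    qed
    also have "\<dots> = 2 * (\<Sum>b\<in>I. of_bool (sens b i))"
      using sum.reindex_bij_betw[OF bij, of "\<lambda>b. of_bool (sens b i) :: nat"]
      by (simp only: sum.distrib mult_2)
    finally show ?thesis .
  qed
  have card_sens: "(\<Sum>i<m. of_bool (sens b i)) = card {i \<in> {..<m}. sens b i}" for b
    by (subst sum_of_bool_eq) (simp_all only: finite_lessThan of_nat_id Int_def mem_Collect_eq)
  have "m * card I = (\<Sum>i<m. card I)" by simp
  also have "\<dots> \<le> (\<Sum>i<m. 2 * (\<Sum>b\<in>I. of_bool (sens b i)))" by (intro sum_mono each) simp
  also have "\<dots> = 2 * (\<Sum>i<m. \<Sum>b\<in>I. of_bool (sens b i))"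
    by (simp only: sum_distrib_left)
  also have "\<dots> = 2 * (\<Sum>b\<in>I. \<Sum>i<m. of_bool (sens b i))"
    by (subst sum.swap) (rule refl)
  also have "\<dots> = (\<Sum>b\<in>I. 2 * card {i \<in> {..<m}. sens b i})"
    by (simp only: sum_distrib_left card_sens)
  also have "\<dots> < (\<Sum>b\<in>I. m)" by (intro sum_strict_mono few finite_I I_nonempty)
  finally show False by simp
qed

lemma bs_crit_ge_half: "m \<le> 2 * bs_crit (verts G) (peb_search G t)"
proof -
  have "(\<lambda>\<alpha>. SOME c. c \<in> peb_search G t \<alpha>) \<in> solvers (verts G) (peb_search G t)"
    using peb_search_total[OF dag sink] by (auto simp: solvers_def some_in_eq)
  \<comment> \<open>\<open>Suc m div 2\<close> is \<open>m / 2\<close> rounded up, which keeps the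
    factor 2 exact.\<close>
  then have "Suc m div 2 \<le> bs_crit (verts G) (peb_search G t)"
  proof (intro bs_crit_ge[OF finite_verts])
    fix f assume "f \<in> solvers (verts G) (peb_search G t)"
    from exists_half_sensitive[OF this] obtain b where b: "b \<in> I"
      "m \<le> 2 * block_sensitivity (verts G) f (path_assignment b)" by blast
    then show "\<exists>\<alpha> \<in> critical_assignments (verts G) (peb_search G t).
        Suc m div 2 \<le> block_sensitivity (verts G) f \<alpha>"
      by (intro bexI[OF _ path_assignment_critical[OF b(1)]]) auto
  qed blast
  then show ?thesis by linarith
qed

end


section \<open>A folded binary tree\<close>

text \<open>
  The infinite binary tree with in-neighbours \<open>2x\<close> and \<open>2x + 1\<close> of \<open>x\<close>, with positions taken
  modulo the width \<open>W\<close> and cut off after \<open>K\<close> levels; the node at position \<open>x\<close> of level \<open>j\<close> is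
  \<open>j W + x\<close>. The second kind of arcs chains up the nodes of level \<open>0\<close>, so that \<open>0\<close> is the only sink.
\<close>

definition fold_arc :: "nat \<Rightarrow> nat \<Rightarrow> nat \<Rightarrow> bool" where
  "fold_arc W v u \<longleftrightarrow>
     v div W = Suc (u div W) \<and> (v mod W = 2 * u mod W \<or> v mod W = Suc (2 * u) mod W) \<or>
     v < W \<and> v = Suc u"

definition folded_tree :: "nat \<Rightarrow> nat \<Rightarrow> (nat, nat \<times> nat) pre_digraph" where
  "folded_tree K W =
     \<lparr>verts = {..<K * W}, arcs = {(v, u). v < K * W \<and> u < K * W \<and> fold_arc W v u},
      tail = fst, head = snd\<rparr>"

section \<open>Arcs of the folded tree: order, bandwidth and degrees\<close>

lemma fold_arc_less:
  assumes "fold_arc W v u"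
  shows "u < v"
proof (rule ccontr)
  assume "\<not> u < v"
  then have "v div W \<le> u div W" by (simp add: div_le_mono)
  with assms \<open>\<not> u < v\<close> show False by (auto simp: fold_arc_def)
qed

text \<open>Tree arcs join consecutive levels of width \<open>W\<close>, hence the bound for
  pebbling with a sliding window.\<close>

lemma fold_arc_bandwidth:
  assumes "fold_arc W v u" "0 < W"
  shows "v < u + 2 * W"
proof (cases "v = Suc u")
  case False
  then have lev: "v div W = Suc (u div W)" using assms(1) by (auto simp: fold_arc_def)
  have "v = v div W * W + v mod W" by simp
  also have "\<dots> < Suc (Suc (u div W)) * W" unfolding lev using assms(2) by simp
  also have "\<dots> \<le> u + 2 * W" using div_times_less_eq_dividend[of u W] by simp
  finally show ?thesis .
qed (use assms(2) in simp)

lemma fold_arc_in_candidates: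
  assumes "fold_arc W v u"
  shows "v \<in> {Suc (u div W) * W + 2 * u mod W, Suc (u div W) * W + Suc (2 * u) mod W, Suc u}"
proof (cases "v = Suc u")
  case False
  then have lev: "v div W = Suc (u div W)" "v mod W = 2 * u mod W \<or> v mod W = Suc (2 * u) mod W"
    using assms by (auto simp: fold_arc_def)
  have "v = Suc (u div W) * W + v mod W" unfolding lev(1)[symmetric] by simp
  with lev(2) show ?thesis by (metis insertI1 insertI2)
qed simp

lemma fold_arc_out_candidates:
  assumes "fold_arc W v u" "0 < W"
  shows "u \<in> {(v div W - 1) * W + v mod W div 2, (v div W - 1) * W + (v mod W + W) div 2, v - 1}"
proof (cases "v = Suc u")
  case False
  then obtain c where c: "v div W = Suc (u div W)" "c \<le> 1" "v mod W = (2 * u + c) mod W"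
    using assms(1) unfolding fold_arc_def by (metis Suc_eq_plus1 add_0_right le_numeral_extra(4) zero_le_one)
  define y where "y = u mod W"
  have y: "y < W" using assms(2) by (simp add: y_def)
  have "v mod W = (2 * y + c) mod W"
    unfolding c(3) y_def by (metis mod_add_left_eq mod_mult_right_eq)
  \<comment> \<open>As \<open>2 * y + c < 2 * W\<close>, reduction subtracts \<open>W\<close> at
    most once, so each node has at most two tree successors.\<close>
  moreover have "(2 * y + c) mod W = (if 2 * y + c < W then 2 * y + c else 2 * y + c - W)"
    using y c(2) by (simp add: mod_if[of "2 * y + c"] le_mod_geq)
  ultimately have "y = v mod W div 2 \<or> y = (v mod W + W) div 2"
    using y c(2) by (auto split: if_splits)
  moreover have "u = (v div W - 1) * W + y" using c(1) by (simp add: y_def)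
  ultimately show ?thesis by auto
qed simp

lemma exists_fold_arc_out:
  assumes "0 < v" "0 < W"
  obtains u where "fold_arc W v u"
proof (cases "v < W")
  case True
  then have "fold_arc W v (v - 1)" using assms by (simp add: fold_arc_def)
  with that show thesis .
next
  case False
  define h where "h = v mod W div 2"
  define u where "u = (v div W - 1) * W + h"
  have vW: "v mod W < W" using assms(2) by simp
  then have h: "h < W" unfolding h_def by linarith
  have "1 \<le> v div W" using False assms(2) by (simp add: Suc_le_eq div_greater_zero_iff)
  then have lev: "v div W = Suc (u div W)" using h by (simp add: u_def)
  have um: "u mod W = h" using h by (simp add: u_def)
  have "v mod W = 2 * h \<or> v mod W = Suc (2 * h)" unfolding h_def by linarith
  then have "v mod W = 2 * u mod W \<or> v mod W = Suc (2 * u) mod W"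
    using vW um by (metis mod_Suc_eq mod_less mod_mult_right_eq)
  with lev have "fold_arc W v u" by (simp add: fold_arc_def)
  with that show thesis .
qed

lemma card_triple_le: "card {a, b, c} \<le> 3"
  by (simp add: card_insert_if)

section \<open>The folded tree as a bounded-degree graph with a single sink\<close>

context
  fixes K W :: nat
  assumes K: "2 \<le> K" and W: "0 < W"
begin

lemma arcs_ends_folded_tree:
  "arcs_ends (folded_tree K W) = {(v, u). v < K * W \<and> u < K * W \<and> fold_arc W v u}"
  by (auto simp: arcs_ends_conv folded_tree_def)

lemma in_neighbours_folded_tree:
  "u < K * W \<Longrightarrow> in_neighbours (folded_tree K W) u = {v. v < K * W \<and> fold_arc W v u}"
  by (auto simp: in_neighbours_def arcs_ends_folded_tree)

lemma verts_folded_tree [simp]: "verts (folded_tree K W) = {..<K * W}"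
  by (simp add: folded_tree_def)

lemma dag_folded_tree: "dag (folded_tree K W)"
proof -
  have "finite {(v, u). v < K * W \<and> u < K * W \<and> fold_arc W v u}"
    by (rule finite_subset[of _ "{..<K * W} \<times> {..<K * W}"]) auto
  then have "digraph (folded_tree K W)"
    by unfold_locales (auto simp: folded_tree_def arc_to_ends_def dest: fold_arc_less)
  moreover have "acyclic (arcs_ends (folded_tree K W))"
  proof (rule acyclic_subset)
    show "acyclic (less_than\<inverse>)" by (simp add: wf_acyclic acyclic_converse)
    show "arcs_ends (folded_tree K W) \<subseteq> less_than\<inverse>"
      by (auto simp: arcs_ends_folded_tree dest: fold_arc_less)
  qed
  ultimately show ?thesis by (simp add: dag_def)
qed

lemma in_degree_folded_tree: "in_degree (folded_tree K W) u \<le> 3"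
proof -
  have "in_arcs (folded_tree K W) u \<subseteq> (\<lambda>v. (v, u)) `
     {Suc (u div W) * W + 2 * u mod W, Suc (u div W) * W + Suc (2 * u) mod W, Suc u}" (is "_ \<subseteq> ?f ` ?S")
  proof
    fix a assume "a \<in> in_arcs (folded_tree K W) u"
    then obtain v where v: "a = (v, u)" "fold_arc W v u"
      by (auto simp: in_arcs_def folded_tree_def)
    show "a \<in> ?f ` ?S" unfolding v(1) using fold_arc_in_candidates[OF v(2)] by (rule imageI)
  qed
  then have "card (in_arcs (folded_tree K W) u) \<le> card (?f ` ?S)"
    by (rule card_mono[rotated]) simp
  also have "\<dots> \<le> card ?S" by (rule card_image_le) simp
  finally show ?thesis using card_triple_le unfolding in_degree_def by (rule order_trans)
qed

lemma out_degree_folded_tree: "out_degree (folded_tree K W) v \<le> 3"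
proof -
  have "out_arcs (folded_tree K W) v \<subseteq> Pair v `
     {(v div W - 1) * W + v mod W div 2, (v div W - 1) * W + (v mod W + W) div 2, v - 1}" (is "_ \<subseteq> ?f ` ?S")
  proof
    fix a assume "a \<in> out_arcs (folded_tree K W) v"
    then obtain u where u: "a = (v, u)" "fold_arc W v u"
      by (auto simp: out_arcs_def folded_tree_def)
    show "a \<in> ?f ` ?S" unfolding u(1) using fold_arc_out_candidates[OF u(2) W] by (rule imageI)
  qed
  then have "card (out_arcs (folded_tree K W) v) \<le> card (?f ` ?S)"
    by (rule card_mono[rotated]) simp
  also have "\<dots> \<le> card ?S" by (rule card_image_le) simp
  finally show ?thesis using card_triple_le unfolding out_degree_def by (rule order_trans)
qed

lemma unique_sink_folded_tree: "unique_sink (folded_tree K W) 0"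
proof -
  have fin: "finite (out_arcs (folded_tree K W) v)" for v
    by (rule finite_subset[of _ "{v} \<times> {..<K * W}"]) (auto simp: out_arcs_def folded_tree_def)
  have "out_arcs (folded_tree K W) 0 = {}"
    by (auto simp: out_arcs_def folded_tree_def dest: fold_arc_less)
  moreover have "out_arcs (folded_tree K W) v \<noteq> {}" if v: "v < K * W" "v \<noteq> 0" for v
  proof -
    obtain u where u: "fold_arc W v u" using exists_fold_arc_out[of v W] v(2) W by blast
    then have "(v, u) \<in> out_arcs (folded_tree K W) v"
      using v(1) fold_arc_less[OF u] by (auto simp: out_arcs_def folded_tree_def)
    then show ?thesis by blast
  qed
  ultimately show ?thesis
    using K W fin by (auto simp: unique_sink_def out_degree_def)
qed

section \<open>Upper bounds for the folded tree\<close>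

lemma folded_tree_pebbling:
  obtains Ps where "Ps \<in> pebblings (folded_tree K W) 0" "\<forall>P \<in> set Ps. card P \<le> Suc (2 * W)"
proof (rule bounded_pebbling_of_bandwidth[of "folded_tree K W" "K * W" "2 * W"])
  show "in_neighbours (folded_tree K W) u \<subseteq> {u<..<min (K * W) (u + 2 * W)}" if "u < K * W" for u
    using fold_arc_less fold_arc_bandwidth[OF _ W]
    by (auto simp: in_neighbours_folded_tree[OF that])
qed (use K W that in auto)

lemma folded_tree_solving_tree:
  obtains T where "queried T \<subseteq> verts (folded_tree K W)"
    "run T \<in> solvers (verts (folded_tree K W)) (peb_search (folded_tree K W) 0)"
    "depth T \<le> Suc (3 * Suc (K + W))"
proof -
  \<comment> \<open>The rank drops by one per level, and on level 0 also along the chain, whose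
    \<open>W\<close> nodes account for the extra \<open>W\<close>.\<close>
  define r where "r v = (if v < W then K + W - v else K - v div W)" for v
  note nb = in_neighbours_folded_tree
  have card: "card (in_neighbours (folded_tree K W) u) \<le> 3" if u: "u < K * W" for u
  proof -
    have "in_neighbours (folded_tree K W) u \<subseteq>
      {Suc (u div W) * W + 2 * u mod W, Suc (u div W) * W + Suc (2 * u) mod W, Suc u}"
      using fold_arc_in_candidates unfolding nb[OF u] by blast
    then have "card (in_neighbours (folded_tree K W) u) \<le> card
      {Suc (u div W) * W + 2 * u mod W, Suc (u div W) * W + Suc (2 * u) mod W, Suc u}"
      by (rule card_mono[rotated]) simp
    then show ?thesis using card_triple_le by (rule order_trans)
  qed
  have rank: "r v < r u" if "u < K * W" "v < K * W" "fold_arc W v u" for u v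
  proof (cases "v < W")
    case True
    then have "v = Suc u" using that(3) by (auto simp: fold_arc_def)
    with True show ?thesis by (simp add: r_def)
  next
    case False
    then have lev: "v div W = Suc (u div W)" using that(3) by (auto simp: fold_arc_def)
    moreover have "v div W < K" using that(2) W by (simp add: div_less_iff_less_mult)
    ultimately show ?thesis using False by (auto simp: r_def)
  qed
  obtain T where "queried T \<subseteq> verts (folded_tree K W)"
    "run T \<in> solvers (verts (folded_tree K W)) (peb_search (folded_tree K W) 0)"
    "depth T \<le> Suc (3 * Suc (r 0))"
  proof (rule peb_search_solving_tree[of "folded_tree K W" 3 r 0])
    show "finite (in_neighbours (folded_tree K W) v)" if "v \<in> verts (folded_tree K W)" for v
      using that by (simp add: nb)
    show "in_neighbours (folded_tree K W) v \<subseteq> verts (folded_tree K W)"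
      if "v \<in> verts (folded_tree K W)" for v using that by (auto simp: nb)
    show "card (in_neighbours (folded_tree K W) v) \<le> 3" if "v \<in> verts (folded_tree K W)" for v
      using that card by simp
    show "r w < r v" if "v \<in> verts (folded_tree K W)" "w \<in> in_neighbours (folded_tree K W) v" for v w
      using that rank by (simp add: nb)
  qed (use K W in auto)
  moreover have "r 0 = K + W" using W by (simp add: r_def)
  ultimately show thesis using that by simp
qed

end


section \<open>Powers of two modulo powers of three\<close>

text \<open>A form of 2 being a primitive root. In the step, \<open>d = 3 * e\<close> because 4 has
  order 3 modulo 9. For \<open>y = 4 ^ e\<close>, which is 1 modulo 3, the cofactor of
  \<open>y - 1\<close> in \<open>y ^ 3 - 1\<close> contains exactly one factor 3, so the
  divisibility passes to \<open>e\<close> with one power less.\<close>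

lemma three_power_dvd_four_power_minus_one:
  assumes "3 ^ Suc k dvd (4 ^ d - 1 :: int)"
  shows "3 ^ k dvd d"
  using assms
proof (induction k arbitrary: d)
  case 0
  show ?case by simp
next
  case (Suc k)
  have "(9 :: int) dvd 3 ^ Suc (Suc k)" by simp
  then have nine: "9 dvd (4 ^ d - 1 :: int)" using Suc.prems by (rule dvd_trans)
  define e where "e = d div 3"
  have four: "(4 :: int) ^ d = 64 ^ e * 4 ^ (d mod 3)"
  proof -
    have "(4 :: int) ^ d = 4 ^ (3 * e + d mod 3)" by (simp add: e_def)
    then show ?thesis by (simp add: power_add power_mult)
  qed
  have "(64 :: int) ^ e mod 9 = 1"
    by (subst power_mod[symmetric]) simp
  then have "(4 :: int) ^ d mod 9 = 4 ^ (d mod 3) mod 9"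
    unfolding four by (metis mod_mult_left_eq mult_1)
  moreover have "(4 :: int) ^ d mod 9 = 1"
    using nine mod_eq_dvd_iff[of "4 ^ d" 9 "1 :: int"] by simp
  moreover have "d mod 3 \<in> {0, 1, 2}" by auto
  ultimately have "d mod 3 = 0" by auto
  then have d: "d = 3 * e" using mult_div_mod_eq[of 3 d] by (simp add: e_def)
  define y :: int where "y = 4 ^ e"
  have "3 dvd y - 1"
  proof -
    have "(4 :: int) ^ e mod 3 = 1" by (subst power_mod[symmetric]) simp
    then show ?thesis using mod_eq_dvd_iff[of y 3 "1 :: int"] by (simp add: y_def)
  qed
  then obtain z where z: "y = 1 + 3 * z" by (auto simp: dvd_def algebra_simps)
  have "4 ^ d - 1 = y ^ 3 - 1" unfolding d y_def by (metis mult.commute power_mult)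
  also have "\<dots> = 3 * ((y - 1) * (1 + 3 * (z + z ^ 2)))"
    unfolding z by (simp add: power2_eq_square power3_eq_cube algebra_simps)
  finally have "3 * 3 ^ Suc k dvd 3 * ((y - 1) * (1 + 3 * (z + z ^ 2)))" using Suc.prems by simp
  then have "3 ^ Suc k dvd (y - 1) * (1 + 3 * (z + z ^ 2))"
    unfolding dvd_mult_cancel_left by (elim disjE) simp_all
  moreover have "coprime (3 ^ Suc k) (1 + 3 * (z + z ^ 2))"
  proof -
    have "coprime 3 (1 + 3 * (z + z ^ 2))"
    proof (rule coprimeI)
      fix c :: int
      assume "c dvd 3" "c dvd 1 + 3 * (z + z ^ 2)"
      then have "c dvd (1 + 3 * (z + z ^ 2)) - 3 * (z + z ^ 2)" by (intro dvd_diff dvd_mult2)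
      then show "is_unit c" by simp
    qed
    then show ?thesis by simp
  qed
  ultimately have "3 ^ Suc k dvd y - 1" using coprime_dvd_mult_left_iff by blast
  then have "3 ^ k dvd e" unfolding y_def by (rule Suc.IH)
  then show ?case unfolding d by simp
qed

text \<open>Multiplying by \<open>2 ^ d + s\<close> reduces both signs to
  \<open>4 ^ d - 1\<close>.\<close>

lemma not_three_power_dvd_two_power:
  fixes s :: int
  assumes "0 < d" "d < 3 ^ k" "\<bar>s\<bar> = 1"
  shows "\<not> 3 ^ Suc k dvd 2 ^ d - s"
proof
  assume "3 ^ Suc k dvd 2 ^ d - s"
  then have "3 ^ Suc k dvd (2 ^ d - s) * (2 ^ d + s)" by simp
  moreover have "(2 ^ d - s) * (2 ^ d + s) = 4 ^ d - 1"
  proof -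
    have "s * s = 1" using assms(3) by (auto simp: abs_if split: if_splits)
    moreover have "(2 :: int) ^ d * 2 ^ d = 4 ^ d" by (simp flip: power_mult_distrib)
    ultimately show ?thesis by (simp add: algebra_simps)
  qed
  ultimately have "3 ^ k dvd d" using three_power_dvd_four_power_minus_one[of k d] by simp
  with assms(1,2) show False by (auto dest: dvd_imp_le)
qed


section \<open>Paths of the folded tree\<close>

text \<open>A bit string is the set of levels that the path leaves through the odd child. Its first
  \<open>j\<close> bits, bit 0 the most significant, spell the position in the unfolded
  tree.\<close>

fun bit_position :: "nat set \<Rightarrow> nat \<Rightarrow> nat" where
  "bit_position b 0 = 0"
| "bit_position b (Suc j) = 2 * bit_position b j + of_bool (j \<in> b)"

definition toggle :: "nat \<Rightarrow> nat set \<Rightarrow> nat set" where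
  "toggle i b = (if i \<in> b then b - {i} else insert i b)"

lemma bit_position_flip_before: "j \<le> i \<Longrightarrow> bit_position (toggle i b) j = bit_position b j"
  by (induction j) (auto simp: toggle_def)

text \<open>Bit \<open>i\<close> has weight \<open>2 ^ d\<close> at level \<open>Suc i + d\<close>.
  Integers are used because the shift may be negative.\<close>

lemma bit_position_flip_after:
  "int (bit_position (toggle i b) (Suc i + d)) =
   int (bit_position b (Suc i + d)) + (if i \<in> b then - 1 else 1) * 2 ^ d"
proof (induction d)
  case 0
  show ?case by (simp add: bit_position_flip_before) (simp add: toggle_def)
next
  case (Suc d)
  have mem: "Suc i + d \<in> toggle i b \<longleftrightarrow> Suc i + d \<in> b" by (simp add: toggle_def)
  have step: "int (bit_position c (Suc i + Suc d)) =
      2 * int (bit_position c (Suc i + d)) + of_bool (Suc i + d \<in> c)" for c by simp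
  show ?case unfolding step mem Suc.IH by simp
qed

lemma three_power_dvd_cancel_two_power:
  assumes "3 ^ k dvd (2 ^ a * z :: int)"
  shows "3 ^ k dvd z"
proof -
  have "coprime (3 ^ k) (2 ^ a :: int)" by simp
  with assms show ?thesis by (simp add: coprime_dvd_mult_right_iff)
qed

text \<open>The shift is a signed power of 2 and so prime to 3: a rerouted path never
  returns.\<close>

lemma bit_position_flip_neq:
  assumes "i < j" "0 < k"
  shows "bit_position (toggle i b) j mod 3 ^ k \<noteq> bit_position b j mod 3 ^ k"
proof
  define d where "d = j - Suc i"
  have j: "j = Suc i + d" using assms(1) by (simp add: d_def)
  define s :: int where "s = (if i \<in> b then - 1 else 1)"
  assume "bit_position (toggle i b) j mod 3 ^ k = bit_position b j mod 3 ^ k"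
  then have "int (bit_position (toggle i b) j) mod 3 ^ k = int (bit_position b j) mod 3 ^ k"
    by (metis of_nat_mod of_nat_numeral of_nat_power)
  then have "3 ^ k dvd 2 ^ d * s"
    unfolding j bit_position_flip_after by (simp add: mod_eq_dvd_iff s_def mult.commute)
  then have "3 ^ k dvd s" by (rule three_power_dvd_cancel_two_power)
  then have "(3 ^ k :: int) dvd 1" by (auto simp: s_def split: if_splits)
  then have "(3 :: int) dvd 1" using assms(2) by (meson dvd_power dvd_trans)
  then show False by simp
qed

text \<open>Two signed powers of 2 agree modulo \<open>3 ^ Suc k\<close> only if
  \<open>2 ^ (l - i)\<close> is 1 or -1 there, which a gap below \<open>3 ^ k\<close>
  excludes.\<close>

lemma bit_position_flips_neq:
  assumes "i < l" "l < j" "l - i < 3 ^ k"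
  shows "bit_position (toggle i b) j mod 3 ^ Suc k \<noteq> bit_position (toggle l b) j mod 3 ^ Suc k"
proof
  define d where "d = j - Suc l"
  have j: "j = Suc l + d" "j = Suc i + (d + (l - i))" using assms(1,2) by (simp_all add: d_def)
  define s s' :: int where "s = (if i \<in> b then - 1 else 1)" and "s' = (if l \<in> b then - 1 else 1)"
  assume "bit_position (toggle i b) j mod 3 ^ Suc k = bit_position (toggle l b) j mod 3 ^ Suc k"
  then have "int (bit_position (toggle i b) j) mod 3 ^ Suc k = int (bit_position (toggle l b) j) mod 3 ^ Suc k"
    by (metis of_nat_mod of_nat_numeral of_nat_power)
  moreover have "int (bit_position (toggle i b) j) = int (bit_position b j) + s * 2 ^ (d + (l - i))"
    unfolding j(2) s_def by (rule bit_position_flip_after)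
  moreover have "int (bit_position (toggle l b) j) = int (bit_position b j) + s' * 2 ^ d"
    unfolding j(1) s'_def by (rule bit_position_flip_after)
  ultimately have "3 ^ Suc k dvd s * 2 ^ (d + (l - i)) - s' * 2 ^ d"
    by (simp only: mod_eq_dvd_iff) simp
  moreover have "s * 2 ^ (d + (l - i)) - s' * 2 ^ d = 2 ^ d * (s * (2 ^ (l - i) - s * s'))"
    by (simp add: power_add algebra_simps s_def)
  ultimately have "3 ^ Suc k dvd s * (2 ^ (l - i) - s * s')"
    using three_power_dvd_cancel_two_power by metis
  then have "3 ^ Suc k dvd 2 ^ (l - i) - s * s'"
    by (cases "i \<in> b") (simp_all only: s_def if_True if_False mult_1 mult_minus1 dvd_minus_iff)
  moreover have "\<bar>s * s'\<bar> = 1" by (simp add: s_def s'_def)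
  ultimately show False using not_three_power_dvd_two_power[of "l - i" k "s * s'"] assms by simp
qed

definition path_node :: "nat \<Rightarrow> nat set \<Rightarrow> nat \<Rightarrow> nat" where
  "path_node W b j = j * W + bit_position b j mod W"

lemma path_node_div: "0 < W \<Longrightarrow> path_node W b j div W = j"
  by (simp add: path_node_def)

lemma path_node_mod: "path_node W b j mod W = bit_position b j mod W"
  by (simp add: path_node_def)

lemma path_node_eq_iff:
  assumes "0 < W"
  shows "path_node W b j = path_node W c l \<longleftrightarrow>
         j = l \<and> bit_position b j mod W = bit_position c l mod W"
  using assms by (metis path_node_def path_node_div path_node_mod)

lemma path_node_less:
  assumes "0 < W" "j < K"
  shows "path_node W b j < K * W"
proof -
  have "path_node W b j < Suc j * W" using assms(1) by (simp add: path_node_def)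
  also have "\<dots> \<le> K * W" using assms(2) by (intro mult_le_mono1) simp
  finally show ?thesis .
qed

lemma fold_arc_path_node:
  assumes "0 < W"
  shows "fold_arc W (path_node W b (Suc j)) (path_node W b j)"
proof -
  have "2 * path_node W b j mod W = 2 * bit_position b j mod W"
    by (metis mod_mult_right_eq path_node_mod)
  moreover from this have "Suc (2 * path_node W b j) mod W = Suc (2 * bit_position b j) mod W"
    by (metis mod_Suc_eq)
  ultimately show ?thesis
    unfolding fold_arc_def path_node_div[OF assms] path_node_mod by simp
qed

text \<open>The \<open>K - 1\<close> bits decide the steps between \<open>K\<close> levels. Indices
  differ by less than \<open>K\<close>, so the distinctness of shifts is available modulo
  \<open>3 * K\<close>, which dictates \<open>W\<close>.\<close>

lemma branching_paths_folded_tree: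
  fixes k :: nat
  defines "K \<equiv> 3 ^ Suc k" and "W \<equiv> 3 ^ Suc (Suc k)"
  shows "branching_paths (folded_tree K W) 0 (Pow {..<K - 1}) (\<lambda>b. path_node W b ` {..<K})
           (\<lambda>b. path_node W b (K - 1)) (K - 1) toggle"
proof -
  have K: "2 \<le> K" unfolding K_def power_Suc using one_le_power[of "3 :: nat" k] by linarith
  have W: "0 < W" by (simp add: W_def)
  note nb = in_neighbours_folded_tree[OF K W]
  show ?thesis
  proof
    show "dag (folded_tree K W)" by (rule dag_folded_tree[OF K W])
    show "unique_sink (folded_tree K W) 0" by (rule unique_sink_folded_tree[OF K W])
    show "finite (Pow {..<K - 1})" "Pow {..<K - 1} \<noteq> {}" by auto
    fix b assume b: "b \<in> Pow {..<K - 1}"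
    show "path_node W b ` {..<K} \<subseteq> verts (folded_tree K W)"
      using path_node_less[OF W] by (auto simp: verts_folded_tree[OF K W])
    show "0 \<in> path_node W b ` {..<K}"
      using K by (intro image_eqI[of _ _ 0]) (simp_all add: path_node_def)
    show "path_node W b (K - 1) \<in> path_node W b ` {..<K}" using K by simp
    show "in_neighbours (folded_tree K W) (path_node W b (K - 1)) = {}"
    proof -
      have "\<not> fold_arc W v (path_node W b (K - 1))" if "v < K * W" for v
      proof
        assume arc: "fold_arc W v (path_node W b (K - 1))"
        have div: "path_node W b (K - 1) div W = K - 1" using W by (simp add: path_node_def)
        have "v div W < K" using that W by (simp add: div_less_iff_less_mult)
        \<comment> \<open>A tree arc would put \<open>v\<close> on the missing level
          \<open>K\<close>. What is left is a chain arc, and these stay on level 0.\<close>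
        then have "v < W" using arc K unfolding fold_arc_def div by auto
        moreover have "path_node W b (K - 1) < v" using arc by (rule fold_arc_less)
        ultimately have "path_node W b (K - 1) div W = 0" by simp
        with div K show False by simp
      qed
      then show ?thesis using path_node_less[OF W, of "K - 1" K b] K by (auto simp: nb)
    qed
    fix v assume v: "v \<in> path_node W b ` {..<K}" "v \<noteq> path_node W b (K - 1)"
    then obtain j where j: "j < K" "v = path_node W b j" by blast
    with v(2) have "Suc j < K" by (metis Suc_lessI diff_Suc_1)
    then show "in_neighbours (folded_tree K W) v \<inter> path_node W b ` {..<K} \<noteq> {}"
      using fold_arc_path_node[OF W, of b j] path_node_less[OF W, of _ K b] j by (auto simp: nb)
  next
    fix i b assume i: "i < K - 1" and b: "b \<in> Pow {..<K - 1}"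
    show "toggle i b \<in> Pow {..<K - 1}" using i b by (auto simp: toggle_def)
    show "toggle i (toggle i b) = b" by (auto simp: toggle_def)
    \<comment> \<open>A node determines its level, so only the last node of the rerouted path could
      coincide, and bit \<open>i\<close> has shifted that one.\<close>
    show "path_node W b (K - 1) \<notin> path_node W (toggle i b) ` {..<K}"
      using bit_position_flip_neq[OF i, of "Suc (Suc k)" b]
      unfolding W_def[symmetric] by (auto simp: path_node_eq_iff[OF W])
  next
    fix i l b assume il: "i < l" "l < K - 1" and b: "b \<in> Pow {..<K - 1}"
    show "path_node W (toggle i b) ` {..<K} \<inter> path_node W (toggle l b) ` {..<K}
            \<subseteq> path_node W b ` {..<K}"
    proof
      fix v assume "v \<in> path_node W (toggle i b) ` {..<K} \<inter> path_node W (toggle l b) ` {..<K}"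
      then obtain j where j: "j < K" "v = path_node W (toggle i b) j"
        "v = path_node W (toggle l b) j" by (auto simp: path_node_eq_iff[OF W])
      show "v \<in> path_node W b ` {..<K}"
      \<comment> \<open>Up to level \<open>l\<close> the path toggled at \<open>l\<close> still
        follows \<open>b\<close>; beyond it both detours have left \<open>b\<close>, by different
        shifts.\<close>
      proof (cases "j \<le> l")
        case True
        then have "v = path_node W b j" using j(3) by (simp add: path_node_def bit_position_flip_before)
        with j(1) show ?thesis by blast
      next
        case False
        have "l - i < 3 ^ Suc k" using il by (simp add: K_def)
        with bit_position_flips_neq[OF il(1), of j "Suc k" b] False
        have "bit_position (toggle i b) j mod W \<noteq> bit_position (toggle l b) j mod W"
          unfolding W_def by simp
        with j(2,3) show ?thesis by (metis path_node_mod)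
      qed
    qed
  qed
qed


section \<open>The three measures\<close>

text \<open>Decision trees get their lower bound from block sensitivity, which in turn gets its
  upper bound from them. The factor 3 avoids fractions: half of \<open>K - 1\<close> is at least
  \<open>K / 3\<close> once \<open>K\<close> is at least 3.\<close>

lemma folded_tree_measures:
  fixes k :: nat
  defines "K \<equiv> 3 ^ Suc k" and "W \<equiv> 3 ^ Suc (Suc k)"
  defines "G \<equiv> folded_tree K W"
  shows "pebbling_number G 0 \<in> {K..7 * K}"
    and "3 * decision_tree_complexity (verts G) (peb_search G 0) \<in> {K..48 * K}"
    and "3 * bs_crit (verts G) (peb_search G 0) \<in> {K..48 * K}"
proof -
  interpret branching_paths G 0 "Pow {..<K - 1}" "\<lambda>b. path_node W b ` {..<K}"
    "\<lambda>b. path_node W b (K - 1)" "K - 1" toggle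
    unfolding G_def K_def W_def by (rule branching_paths_folded_tree)
  have K: "3 \<le> K" unfolding K_def power_Suc using one_le_power[of "3 :: nat" k] by linarith
  then have K2: "2 \<le> K" by simp
  have W: "W = 3 * K" "0 < W" by (simp_all add: W_def K_def)
  obtain Ps where Ps: "Ps \<in> pebblings G 0" "\<forall>P \<in> set Ps. card P \<le> Suc (2 * W)"
    unfolding G_def using folded_tree_pebbling[OF K2 W(2)] by blast
  have "pebbling_number G 0 \<le> 7 * K" using pebbling_number_le[OF Ps] W K by simp
  moreover have "K \<le> pebbling_number G 0"
    using Ps(1) pebbling_needs_many_pebbles K by (intro pebbling_number_ge) auto
  ultimately show "pebbling_number G 0 \<in> {K..7 * K}" by simp
  obtain T where T: "queried T \<subseteq> verts G" "run T \<in> solvers (verts G) (peb_search G 0)"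
    "depth T \<le> Suc (3 * Suc (K + W))"
    unfolding G_def using folded_tree_solving_tree[OF K2 W(2)] by blast
  have "decision_tree_complexity (verts G) (peb_search G 0) \<le> 16 * K"
    using decision_tree_complexity_le[OF T(1,2)] T(3) W K by simp
  moreover have "bs_crit (verts G) (peb_search G 0) \<le> decision_tree_complexity (verts G) (peb_search G 0)"
    using T by (intro bs_crit_le_decision_tree_complexity[OF finite_verts, of T]) simp
  moreover have "K \<le> 3 * bs_crit (verts G) (peb_search G 0)"
    using bs_crit_ge_half K by simp
  ultimately show "3 * decision_tree_complexity (verts G) (peb_search G 0) \<in> {K..48 * K}"
    "3 * bs_crit (verts G) (peb_search G 0) \<in> {K..48 * K}" by simp_all
qed

text \<open>With \<open>n = s k\<close> the root of \<open>n\<close> is \<open>sqrt 3 * K k\<close>,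
  and \<open>sqrt 3\<close> lies between 1 and 2. The filter restricts the limit to the sizes that
  occur.\<close>

lemma bigtheta_on_range:
  fixes f :: "nat \<Rightarrow> nat"
  assumes size: "\<And>k. s k = 3 * (K k)\<^sup>2" and f: "\<And>k. 3 * f (s k) \<in> {K k..48 * K k}"
  shows "(\<lambda>n. real (f n)) \<in> \<Theta>[inf at_top (principal (range s))](\<lambda>n. sqrt (real n))"
proof -
  have bounds: "sqrt (real (s k)) / 6 \<le> real (f (s k)) \<and> real (f (s k)) \<le> 16 * sqrt (real (s k))" for k
  proof -
    have "sqrt (real (s k)) = sqrt 3 * real (K k)" by (simp add: size real_sqrt_mult)
    moreover have "1 \<le> sqrt 3" "sqrt 3 \<le> (2 :: real)" by (simp_all add: real_le_lsqrt)
    ultimately have "real (K k) \<le> sqrt (real (s k))" "sqrt (real (s k)) \<le> 2 * real (K k)"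
      using mult_right_mono[of 1 "sqrt 3" "real (K k)"] mult_right_mono[of "sqrt 3" 2 "real (K k)"]
      by simp_all
    moreover have "real (K k) \<le> 3 * real (f (s k))" "3 * real (f (s k)) \<le> 48 * real (K k)"
      using f[of k] by (simp_all flip: of_nat_mult)
    ultimately show ?thesis by linarith
  qed
  show ?thesis
  proof (rule bigthetaI'[of "1 / 6" 16])
    show "\<forall>\<^sub>F n in inf at_top (principal (range s)).
        1 / 6 * norm (sqrt (real n)) \<le> norm (real (f n)) \<and>
        norm (real (f n)) \<le> 16 * norm (sqrt (real n))"
      using bounds by (auto simp: eventually_inf_principal intro!: always_eventually)
  qed simp_all
qed

theorem theorem4:
  shows "\<exists>(N :: nat set) (G :: nat \<Rightarrow> (nat, nat \<times> nat) pre_digraph) (t :: nat \<Rightarrow> nat) (D :: nat).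
    infinite N \<and>
    (\<forall>n \<in> N. dag (G n) \<and> unique_sink (G n) (t n) \<and> card (verts (G n)) = n \<and>
       (\<forall>v \<in> verts (G n). in_degree (G n) v \<le> D \<and> out_degree (G n) v \<le> D)) \<and>
    (\<lambda>n. real (pebbling_number (G n) (t n)))
      \<in> \<Theta>[inf at_top (principal N)](\<lambda>n. sqrt (real n)) \<and>
    (\<lambda>n. real (decision_tree_complexity (verts (G n)) (peb_search (G n) (t n))))
      \<in> \<Theta>[inf at_top (principal N)](\<lambda>n. sqrt (real n)) \<and>
    (\<lambda>n. real (bs_crit (verts (G n)) (peb_search (G n) (t n))))
      \<in> \<Theta>[inf at_top (principal N)](\<lambda>n. sqrt (real n))"
proof -
  define H :: "nat \<Rightarrow> (nat, nat \<times> nat) pre_digraph"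
    where "H k = folded_tree (3 ^ Suc k) (3 ^ Suc (Suc k))" for k
  define nodes :: "nat \<Rightarrow> nat" where "nodes k = 3 * (3 ^ Suc k)\<^sup>2" for k
  \<comment> \<open>The family is reindexed by its number of nodes; for other \<open>n\<close> the
    value is some irrelevant member of the family.\<close>
  define G where "G n = H (inv nodes n)" for n
  define t :: "nat \<Rightarrow> nat" where "t n = 0" for n
  have inj: "inj nodes"
    by (intro injI) (simp add: nodes_def power2_eq_iff_nonneg)
  have G: "G (nodes k) = H k" for k by (simp add: G_def inv_f_f[OF inj])
  have pos: "(2 :: nat) \<le> 3 ^ Suc k" "(0 :: nat) < 3 ^ Suc (Suc k)" for k
    unfolding power_Suc using one_le_power[of "3 :: nat" k] by linarith+
  have infinite: "infinite (range nodes)" using inj by (rule range_inj_infinite)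
  have graph: "\<forall>n \<in> range nodes. dag (G n) \<and> unique_sink (G n) (t n) \<and> card (verts (G n)) = n \<and>
       (\<forall>v \<in> verts (G n). in_degree (G n) v \<le> 3 \<and> out_degree (G n) v \<le> 3)"
  proof
    fix n assume "n \<in> range nodes"
    then obtain k where n: "n = nodes k" by blast
    have "card (verts (H k)) = nodes k"
      unfolding H_def verts_folded_tree[OF pos] by (simp add: nodes_def power2_eq_square)
    then show "dag (G n) \<and> unique_sink (G n) (t n) \<and> card (verts (G n)) = n \<and>
       (\<forall>v \<in> verts (G n). in_degree (G n) v \<le> 3 \<and> out_degree (G n) v \<le> 3)"
      unfolding n G t_def using dag_folded_tree[OF pos] unique_sink_folded_tree[OF pos]
        in_degree_folded_tree[OF pos] out_degree_folded_tree[OF pos] by (simp add: H_def)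
  qed
  have measures: "3 * pebbling_number (G (nodes k)) (t (nodes k)) \<in> {3 ^ Suc k..48 * 3 ^ Suc k}"
    "3 * decision_tree_complexity (verts (G (nodes k))) (peb_search (G (nodes k)) (t (nodes k)))
       \<in> {3 ^ Suc k..48 * 3 ^ Suc k}"
    "3 * bs_crit (verts (G (nodes k))) (peb_search (G (nodes k)) (t (nodes k)))
       \<in> {3 ^ Suc k..48 * 3 ^ Suc k}" for k
    using folded_tree_measures[of k] unfolding G t_def H_def by simp_all
  have bigtheta: "(\<lambda>n. real (f n)) \<in> \<Theta>[inf at_top (principal (range nodes))](\<lambda>n. sqrt (real n))"
    if "\<And>k. 3 * f (nodes k) \<in> {3 ^ Suc k..48 * 3 ^ Suc k}" for f
    by (rule bigtheta_on_range[of nodes "\<lambda>k. 3 ^ Suc k" f, OF nodes_def that])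
  show ?thesis
    by (intro exI[of _ "range nodes"] exI[of _ G] exI[of _ t] exI[of _ 3] conjI
        infinite graph bigtheta measures)
qed

end
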